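(* Let $s \ge 2$ and $n > s$ be integers. If $F_{s,k}(n) \ne 0$ for all $k \in \{1, 2, \dots, n\}$, then the map $\mathrm{pre}_s$ is injective on the set of all partitions of length $n$ (of arbitrary size); that is, if $\lambda$ and $\mu$ are partitions of length $n$, not necessarily of the same size, with $\mathrm{pre}_s(\lambda) = \mathrm{pre}_s(\mu)$, then $\lambda = \mu$. In particular: (i) $\mathrm{pre}_5$ is injective on the set of all partitions of length $n$ for every integer $n > 5$ with $n \neq 10$; (ii) $\mathrm{pre}_4$ is injective on the set of all partitions of length $n$ for every integer $n > 4$ with $n \notin \{8, 12\}$; (iii) $\mathrm{pre}_3$ is injective on the set of all partitions of length $n$ for every integer $n > 3$ with $n \notin \{6, 27, 486\}$.
   Context: A partition of length $n$ is a weakly decreasing sequence $\lambda = (\lambda_1, \dots, \lambda_n)$ of positive integers; its size is $|\lambda| = \sum_{i=1}^n \lambda_i$. For $n \ge s$, the elementary symmetric partition map sends $\lambda$ to the multiset (equivalently, partition) of $\binom{n}{s}$ products $$\mathrm{pre}_s(\lambda) = \{\!\!\{ \lambda_{i_1}\lambda_{i_2}\cdots\lambda_{i_s} : 1 \le i_1 < i_2 < \dots < i_s \le n \}\!\!\}.$$ For integers $s, k \ge 1$, the Moser polynomial is $$F_{s,k}(n) = \sum_{p=1}^s (-1)^{p-1} p^{k-1} \binom{n}{s-p}.$$ *)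

theory Defs
  imports "HOL-Library.Multiset"
begin

definition partitions_of_length :: "nat \<Rightarrow> nat list set" where
  "partitions_of_length n =
    {xs. length xs = n \<and> sorted_wrt (\<ge>) xs \<and> (\<forall>x\<in>set xs. 0 < x)}"

text \<open>
  The parts of a partition \<open>xs\<close> are \<open>xs ! 0, \<dots>, xs ! (n - 1)\<close>. An index tuple
  \<open>i\<^sub>1 < \<dots> < i\<^sub>s\<close> is encoded as the \<open>s\<close>-element set of its entries. Equal products coming from
  different index sets are counted separately.
\<close>

definition pre :: "nat \<Rightarrow> nat list \<Rightarrow> nat multiset" where
  "pre s xs =
    image_mset (\<lambda>I. \<Prod>i\<in>I. xs ! i) (mset_set {I. I \<subseteq> {..<length xs} \<and> card I = s})"

text \<open>
  The Moser polynomial is only meaningful for \<open>s, k \<ge> 1\<close>; none of the subtractions on natural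
  numbers below truncates in that range. It is integer-valued because of the alternating signs.
\<close>

definition moser_poly :: "nat \<Rightarrow> nat \<Rightarrow> nat \<Rightarrow> int" where
  "moser_poly s k n =
    (\<Sum>p=1..s. (-1) ^ (p - 1) * int p ^ (k - 1) * int (n choose (s - p)))"

end

theory Submission
  imports Defs "HOL-Computational_Algebra.Computational_Algebra"
begin

text \<open>
Taking logarithms turns the products in \<open>pre s\<close> into sums, so the question becomes when a family of
\<open>n\<close> real numbers \<open>x\<close> is determined, up to order, by the multiset of its \<open>s\<close>-fold subset sums. Encode
the family by the exponential generating function \<open>E(t) = (\<Sum>i. exp (t * x i))\<close> of its power sums.
The generating function of the subset sums is the elementary symmetric function \<open>e\<^sub>s\<close> of the series
\<open>exp (t * x i)\<close>, and by Newton's identities it is a polynomial in \<open>E(t), E(2t), \<dots>, E(s t)\<close>. If two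
families have the same power sums of all exponents below \<open>k\<close>, then the two functions \<open>E(t)\<close> differ by
\<open>c * t^k\<close> to lowest order; linearising the polynomial at the constant term \<open>n\<close>, the two functions
\<open>e\<^sub>s\<close> differ by \<open>moser_poly s k n * c * t^k\<close> (\<open>esym_fps_exp_first_difference\<close>). So if the Moser
polynomial does not vanish, equality of the subset sums propagates equality of the power sums from the
exponents below \<open>k\<close> to \<open>k\<close>, and the power sums of exponents \<open>1, \<dots>, n\<close> determine the family
(\<open>power_sums_determine_multiset\<close>). This is \<open>inj_on_pre\<close>.

What remains is Diophantine: for \<open>s = 3, 4, 5\<close> the equation \<open>moser_poly s k n = 0\<close> has no solution with
\<open>k \<ge> 1\<close> and \<open>n > s\<close> apart from the listed values of \<open>n\<close>. After clearing denominators it is a monic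
polynomial equation in \<open>n\<close> with constant term \<open>\<plusminus> (s-1)! * s^(k-1)\<close>, so \<open>n\<close> is a small factor times a prime
power.

For \<open>s = 3\<close> the two roots in \<open>n\<close> are \<open>3^a\<close> and \<open>2 * 3^b\<close> with sum \<open>2^k + 1\<close>; the power of 3 dividing
\<open>2^k + 1\<close> is at most \<open>3 * k\<close>, which bounds \<open>k\<close>. For \<open>s = 4\<close> reduction modulo 16 excludes all \<open>n\<close>
except a few small ones (and small \<open>k\<close>) and those that are too large to be a root. For \<open>s = 5\<close> put \<open>n = d * 5^a\<close> with
\<open>d\<close> dividing 24. Small \<open>a\<close> are excluded by congruences, \<open>a\<close> close to \<open>k\<close> by size, and in the remaining
range reduction modulo 625 leaves twelve classes of \<open>k\<close> modulo 500; none of these is compatible, for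
any \<open>d\<close> and any class of \<open>a\<close> modulo 25, with the equation modulo both 101 and 251. These two primes
are convenient because the periods of the powers of 2, 3, 4 modulo them divide 500 and 5 has order 25
modulo both; that nothing survives is a finite computation.
\<close>

section \<open>Elementary symmetric functions and Newton's identities\<close>

definition esym :: "'i set \<Rightarrow> ('i \<Rightarrow> 'a) \<Rightarrow> nat \<Rightarrow> 'a::comm_ring_1" where
  "esym A y s = (\<Sum>I | I \<subseteq> A \<and> card I = s. \<Prod>i\<in>I. y i)"

lemma esym_0 [simp]: assumes "finite A" shows "esym A y 0 = 1"
proof -
  have "{I. I \<subseteq> A \<and> card I = 0} = {{}}" using assms by (auto dest: finite_subset)
  then show ?thesis by (simp add: esym_def)
qed

lemma esym_eq_0: assumes "finite A" "card A < s" shows "esym A y s = 0"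
  unfolding esym_def
proof (rule sum.neutral, clarify)
  fix I assume "I \<subseteq> A" "s = card I"
  with assms have False using card_mono[of A I] by simp
  then show "prod y I = 0" ..
qed

lemma esym_insert:
  assumes "finite A" "a \<notin> A"
  shows "esym (insert a A) y (Suc s) = esym A y (Suc s) + y a * esym A y s"
proof -
  have split: "{I. I \<subseteq> insert a A \<and> card I = Suc s} =
      {I. I \<subseteq> A \<and> card I = Suc s} \<union> insert a ` {I. I \<subseteq> A \<and> card I = s}" (is "?L = ?M \<union> ?R")
  proof (intro equalityI subsetI)
    fix I assume I: "I \<in> ?L"
    show "I \<in> ?M \<union> ?R"
    proof (cases "a \<in> I")
      case True
      then have "I = insert a (I - {a})" by blast
      moreover have "I - {a} \<in> {I. I \<subseteq> A \<and> card I = s}" using I True by auto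
      ultimately show ?thesis by blast
    qed (use I in auto)
  next
    fix I assume I: "I \<in> ?M \<union> ?R"
    have "card (insert a J) = Suc (card J)" if "J \<subseteq> A" for J
      using that assms by (meson card_insert_disjoint finite_subset in_mono)
    then show "I \<in> ?L" using I by auto
  qed
  have "?M \<inter> ?R = {}" using assms by blast
  then have "esym (insert a A) y (Suc s) = esym A y (Suc s) + (\<Sum>I\<in>?R. \<Prod>i\<in>I. y i)"
    unfolding esym_def split using assms by (subst sum.union_disjoint) auto
  also have "(\<Sum>I\<in>?R. \<Prod>i\<in>I. y i) = (\<Sum>I | I \<subseteq> A \<and> card I = s. \<Prod>i\<in>insert a I. y i)"
    by (rule sum.reindex[unfolded o_def]) (use assms in \<open>auto simp: inj_on_def\<close>)
  also have "\<dots> = (\<Sum>I | I \<subseteq> A \<and> card I = s. y a * (\<Prod>i\<in>I. y i))"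
  proof (rule sum.cong)
    fix I assume "I \<in> {I. I \<subseteq> A \<and> card I = s}"
    then have "finite I" "a \<notin> I" using assms finite_subset by blast+
    then show "(\<Prod>i\<in>insert a I. y i) = y a * (\<Prod>i\<in>I. y i)" by simp
  qed simp
  finally show ?thesis by (simp add: esym_def sum_distrib_left)
qed

lemma esym_all_ones: "finite A \<Longrightarrow> esym A (\<lambda>_. 1) s = of_nat (card A choose s)"
  by (simp add: esym_def n_subsets)

text \<open>
Induction on the index set: adding an index \<open>a\<close> to \<open>A\<close> changes the right-hand side by terms containing
\<open>y a\<close>, and those with \<open>y a ^ p\<close> telescope.
\<close>

lemma newton_identity:
  assumes "finite A"
  shows "of_nat s * esym A y s =
    (\<Sum>p=1..s. (-1) ^ (p - 1) * esym A y (s - p) * (\<Sum>i\<in>A. y i ^ p))"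
  using assms
proof (induction A arbitrary: s rule: finite_induct)
  case empty
  then show ?case by (cases s) (simp_all add: esym_eq_0)
next
  case (insert a A)
  show ?case
  proof (cases s)
    case (Suc r)
    define c :: "nat \<Rightarrow> 'b" where "c p = (-1) ^ (p - 1)" for p
    define P where "P p = (\<Sum>i\<in>A. y i ^ p)" for p
    let ?e = "esym A y" and ?e' = "esym (insert a A) y"
    have e': "?e' (Suc r - p) = ?e (Suc r - p) + y a * ?e (r - p)" if "p \<le> r" for p
      using insert.hyps that by (simp add: Suc_diff_le esym_insert)
    have IH: "of_nat m * ?e m = (\<Sum>p=1..m. c p * ?e (m - p) * P p)" for m
      unfolding c_def P_def by (rule insert.IH)
    have telescope: "(\<Sum>p=1..r. c p * (?e (Suc r - p) + y a * ?e (r - p)) * y a ^ p)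
        = y a * ?e r - c (Suc r) * y a ^ Suc r"
    proof -
      define f where "f p = - (c p * ?e (Suc r - p) * y a ^ p)" for p
      have "(\<Sum>p=1..r. c p * (?e (Suc r - p) + y a * ?e (r - p)) * y a ^ p) =
        (\<Sum>p=1..r. f (Suc p) - f p)"
      proof (rule sum.cong)
        fix p assume "p \<in> {1..r}"
        then have "c (Suc p) = - c p" unfolding c_def by (cases p) auto
        then show "c p * (?e (Suc r - p) + y a * ?e (r - p)) * y a ^ p = f (Suc p) - f p"
          unfolding f_def by (simp add: algebra_simps)
      qed simp
      also have "\<dots> = f (Suc r) - f 1" by (simp add: sum_Suc_diff)
      finally show ?thesis unfolding f_def c_def using insert.hyps by (simp add: algebra_simps)
    qed
    have "(\<Sum>p=1..Suc r. c p * ?e' (Suc r - p) * (\<Sum>i\<in>insert a A. y i ^ p))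
        = (\<Sum>p=1..r. c p * ?e' (Suc r - p) * (y a ^ p + P p)) + c (Suc r) * (y a ^ Suc r + P (Suc r))"
      using insert.hyps by (simp add: P_def)
    also have "(\<Sum>p=1..r. c p * ?e' (Suc r - p) * (y a ^ p + P p))
        = (\<Sum>p=1..r. c p * (?e (Suc r - p) + y a * ?e (r - p)) * y a ^ p
            + c p * ?e (Suc r - p) * P p + y a * (c p * ?e (r - p) * P p))"
      by (rule sum.cong) (auto simp: e' algebra_simps)
    also have "\<dots> = y a * ?e r - c (Suc r) * y a ^ Suc r
        + (\<Sum>p=1..r. c p * ?e (Suc r - p) * P p) + y a * (of_nat r * ?e r)"
      by (simp only: sum.distrib telescope IH[of r] sum_distrib_left)
    finally have "(\<Sum>p=1..Suc r. c p * ?e' (Suc r - p) * (\<Sum>i\<in>insert a A. y i ^ p))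
        = y a * ?e r + (\<Sum>p=1..Suc r. c p * ?e (Suc r - p) * P p) + y a * (of_nat r * ?e r)"
      using insert.hyps by (simp add: algebra_simps)
    also have "\<dots> = of_nat (Suc r) * ?e' (Suc r)"
      unfolding IH[of "Suc r", symmetric] using insert.hyps by (simp add: esym_insert algebra_simps)
    finally show ?thesis unfolding Suc c_def by simp
  qed simp
qed

lemma prod_eq_esym_sum:
  assumes "finite A"
  shows "(\<Prod>i\<in>A. t + y i) = (\<Sum>j\<le>card A. t ^ (card A - j) * esym A y j)"
  using assms
proof (induction A rule: finite_induct)
  case (insert a A)
  let ?n = "card A" and ?e = "esym A y"
  have "t * (\<Sum>j\<le>?n. t ^ (?n - j) * ?e j) = (\<Sum>j\<le>?n. t ^ (Suc ?n - j) * ?e j)"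
    by (simp add: sum_distrib_left Suc_diff_le mult.assoc)
  also have "\<dots> = (\<Sum>j\<le>Suc ?n. t ^ (Suc ?n - j) * ?e j)"
    using insert.hyps by (simp add: esym_eq_0)
  also have "\<dots> = t ^ Suc ?n + (\<Sum>j\<le>?n. t ^ (?n - j) * ?e (Suc j))"
    using insert.hyps by (subst sum.atMost_Suc_shift) simp
  finally have "(\<Prod>i\<in>insert a A. t + y i) =
      t ^ Suc ?n + (\<Sum>j\<le>?n. t ^ (?n - j) * (?e (Suc j) + y a * ?e j))"
    using insert by (simp add: algebra_simps sum.distrib sum_distrib_left)
  also have "\<dots> = (\<Sum>j\<le>Suc ?n. t ^ (Suc ?n - j) * esym (insert a A) y j)"
    using insert.hyps by (subst sum.atMost_Suc_shift) (simp add: esym_insert)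
  finally show ?case using insert.hyps by simp
qed simp

text \<open>
By Newton's identities the power sums determine the elementary symmetric functions one after the other
(this divides by \<open>j\<close>, so characteristic 0 matters), hence the polynomial with roots \<open>- x i\<close>, hence
the multiset of its roots.
\<close>

lemma power_sums_determine_multiset:
  fixes x y :: "'i \<Rightarrow> real"
  assumes "finite A" and P: "\<And>k. k \<in> {1..card A} \<Longrightarrow> (\<Sum>i\<in>A. x i ^ k) = (\<Sum>i\<in>A. y i ^ k)"
  shows "image_mset x (mset_set A) = image_mset y (mset_set A)"
proof -
  have e: "esym A x j = esym A y j" if "j \<le> card A" for j
    using that
  proof (induction j rule: less_induct)
    case (less j)
    have "real j * esym A x j = real j * esym A y j"
      unfolding newton_identity[OF \<open>finite A\<close>]
    proof (rule sum.cong)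
      fix p assume p: "p \<in> {1..j}"
      then have "esym A x (j - p) = esym A y (j - p)" using less.prems by (intro less.IH) auto
      moreover have "(\<Sum>i\<in>A. x i ^ p) = (\<Sum>i\<in>A. y i ^ p)" using p less.prems by (intro P) auto
      ultimately show "(-1) ^ (p - 1) * esym A x (j - p) * (\<Sum>i\<in>A. x i ^ p) =
        (-1) ^ (p - 1) * esym A y (j - p) * (\<Sum>i\<in>A. y i ^ p)" by (simp only:)
    qed simp
    then show ?case using \<open>finite A\<close> by (cases "j = 0") auto
  qed
  \<comment> \<open>constant polynomials commute with \<open>esym\<close>, so \<open>prod_eq_esym_sum\<close> applies with \<open>t\<close> the variable \<open>[:0, 1:]\<close>\<close>
  have C: "esym A (\<lambda>i. [:z i:]) j = [:esym A z j:]" for z :: "'i \<Rightarrow> real" and j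
  proof -
    have s: "(\<Sum>a\<in>B. [:h a:]) = [:\<Sum>a\<in>B. h a:]" for B :: "'i set set" and h :: "'i set \<Rightarrow> real"
      by (induction B rule: infinite_finite_induct) auto
    have p: "(\<Prod>a\<in>B. [:z a:]) = [:\<Prod>a\<in>B. z a:]" for B
      by (induction B rule: infinite_finite_induct) auto
    show ?thesis unfolding esym_def p s ..
  qed
  have "proots (\<Prod>i\<in>A. [:0, 1:] + [:z i:]) = image_mset (\<lambda>i. - z i) (mset_set A)" for z :: "'i \<Rightarrow> real"
    using \<open>finite A\<close>
    by (subst proots_prod) (auto simp: sum_unfold_sum_mset multiset.map_comp)
  moreover have "(\<Prod>i\<in>A. [:0, 1:] + [:x i:]) = (\<Prod>i\<in>A. [:0, 1:] + [:y i:])"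
    unfolding prod_eq_esym_sum[OF \<open>finite A\<close>] C by (rule sum.cong) (use e in auto)
  ultimately have "image_mset (\<lambda>i. - x i) (mset_set A) = image_mset (\<lambda>i. - y i) (mset_set A)"
    by metis
  then have "image_mset uminus (image_mset (\<lambda>i. - x i) (mset_set A)) = image_mset uminus (image_mset (\<lambda>i. - y i) (mset_set A))"
    by simp
  then show ?thesis by (simp add: multiset.map_comp o_def)
qed

section \<open>Recovering a family of reals from its subset sums\<close>

text \<open>
The recursion that Newton's identities impose on the linear coefficient of \<open>e\<^sub>s\<close>: in each product
\<open>e\<^sub>s\<^sub>-\<^sub>p * E(p t)\<close> either the first factor contributes its linear part and the second its constant term
\<open>n\<close>, or the first contributes its constant term \<open>n choose (s - p)\<close> and the second its \<open>k\<close>-th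
coefficient, which is scaled by \<open>p ^ k\<close>. Comparing the coefficients of \<open>q ^ (k - 1)\<close> reduces this to
Newton's identity for the constant family 1.
\<close>

lemma moser_poly_newton:
  assumes "k \<ge> 1"
  shows "int s * moser_poly s k n = (\<Sum>p=1..s. (-1) ^ (p - 1) *
    (int n * moser_poly (s - p) k n + int p ^ k * int (n choose (s - p))))"
proof -
  define c :: "nat \<Rightarrow> int" where "c p = (-1) ^ (p - 1)" for p
  have ones: "int m * int (n choose m) = (\<Sum>p=1..m. c p * int (n choose (m - p)) * int n)" for m
    using newton_identity[of "{..<n}" m "\<lambda>_. 1 :: int"] by (simp add: esym_all_ones c_def)
  have "(\<Sum>p=1..s. c p * (int n * moser_poly (s - p) k n))
      = (\<Sum>p=1..s. \<Sum>q | q \<in> {1..s} \<and> p + q \<le> s. c p * (int n * (c q * int q ^ (k - 1) * int (n choose (s - p - q)))))"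
    unfolding moser_poly_def sum_distrib_left c_def
    by (intro sum.cong) auto
  also have "\<dots> = (\<Sum>q=1..s. \<Sum>p | p \<in> {1..s} \<and> p + q \<le> s. c p * (int n * (c q * int q ^ (k - 1) * int (n choose (s - p - q)))))"
    by (rule sum.swap_restrict) auto
  also have "\<dots> = (\<Sum>q=1..s. c q * int q ^ (k - 1) * (\<Sum>p=1..s-q. c p * int (n choose (s - q - p)) * int n))"
    unfolding sum_distrib_left
    by (intro sum.cong) (auto simp: add.commute diff_right_commute algebra_simps)
  also have "\<dots> = (\<Sum>q=1..s. c q * int q ^ (k - 1) * (int (s - q) * int (n choose (s - q))))"
    unfolding ones ..
  finally have "(\<Sum>p=1..s. c p * (int n * moser_poly (s - p) k n)) + (\<Sum>p=1..s. c p * (int p ^ k * int (n choose (s - p))))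
     = (\<Sum>q=1..s. c q * int q ^ (k - 1) * (int (s - q) * int (n choose (s - q))) + c q * (int q ^ k * int (n choose (s - q))))"
    by (simp add: sum.distrib)
  also have "\<dots> = (\<Sum>q=1..s. int s * (c q * int q ^ (k - 1) * int (n choose (s - q))))"
  proof (rule sum.cong)
    fix q assume q: "q \<in> {1..s}"
    have "int q ^ k = int q * int q ^ (k - 1)" using assms by (cases k) auto
    with q show "c q * int q ^ (k - 1) * (int (s - q) * int (n choose (s - q))) + c q * (int q ^ k * int (n choose (s - q)))
      = int s * (c q * int q ^ (k - 1) * int (n choose (s - q)))"
      by (simp add: algebra_simps of_nat_diff)
  qed simp
  finally show ?thesis
    unfolding moser_poly_def[of s] sum_distrib_left c_def by (simp add: sum.distrib distrib_left)
qed

lemma esym_fps_exp: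
  fixes x :: "'i \<Rightarrow> real"
  shows "esym A (\<lambda>i. fps_exp (x i)) s = (\<Sum>I | I \<subseteq> A \<and> card I = s. fps_exp (\<Sum>i\<in>I. x i))"
proof -
  have "(\<Prod>i\<in>I. fps_exp (x i)) = fps_exp (\<Sum>i\<in>I. x i)" for I
    by (induction I rule: infinite_finite_induct) (auto simp: fps_exp_add_mult)
  then show ?thesis by (simp add: esym_def)
qed

text \<open>
\<open>moser_poly s k n\<close> is the derivative of the coefficient of \<open>t ^ k\<close> in \<open>e\<^sub>s\<close> with respect to the \<open>k\<close>-th
coefficient of \<open>E(t)\<close>. No remainder term appears, because the series involved differ only from
\<open>t ^ k\<close> on, so that a product with a second such difference cannot contribute to \<open>t ^ k\<close>.
\<close>

lemma esym_fps_exp_first_difference: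
  fixes x y :: "'i \<Rightarrow> real"
  assumes "finite A" "k \<ge> 1" and P: "\<And>j. j < k \<Longrightarrow> (\<Sum>i\<in>A. x i ^ j) = (\<Sum>i\<in>A. y i ^ j)"
  shows "(\<forall>j<k. (esym A (\<lambda>i. fps_exp (x i)) s - esym A (\<lambda>i. fps_exp (y i)) s) $ j = 0) \<and>
    (esym A (\<lambda>i. fps_exp (x i)) s - esym A (\<lambda>i. fps_exp (y i)) s) $ k =
      moser_poly s k (card A) * (((\<Sum>i\<in>A. x i ^ k) - (\<Sum>i\<in>A. y i ^ k)) / fact k)"
proof (induction s rule: less_induct)
  case (less s)
  let ?X = "\<lambda>i. fps_exp (x i)" and ?Y = "\<lambda>i. fps_exp (y i)"
  let ?n = "card A"
  define D where "D s = esym A ?X s - esym A ?Y s" for s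
  define Q where "Q z p = (\<Sum>i\<in>A. fps_exp (z i) ^ p)" for z :: "'i \<Rightarrow> real" and p
  define c where "c = ((\<Sum>i\<in>A. x i ^ k) - (\<Sum>i\<in>A. y i ^ k)) / fact k"
  have Q: "Q z p $ j = real p ^ j * (\<Sum>i\<in>A. z i ^ j) / fact j" for z p j
    by (simp add: Q_def fps_exp_power_mult fps_sum_nth power_mult_distrib sum_divide_distrib sum_distrib_left)
  have Y0: "esym A ?Y m $ 0 = real (?n choose m)" for m
    using \<open>finite A\<close> by (simp add: esym_fps_exp fps_sum_nth n_subsets)
  define T where "T p = (-1) ^ (p - 1) * (D (s - p) * Q x p + esym A ?Y (s - p) * (Q x p - Q y p))" for p
  have DT: "of_nat s * D s = (\<Sum>p=1..s. T p)"
  proof -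
    have "of_nat s * D s = (\<Sum>p=1..s. (-1) ^ (p - 1) * esym A ?X (s - p) * Q x p
        - (-1) ^ (p - 1) * esym A ?Y (s - p) * Q y p)"
      by (simp only: D_def right_diff_distrib newton_identity[OF \<open>finite A\<close>, of s] sum_subtractf Q_def)
    also have "\<dots> = (\<Sum>p=1..s. T p)"
      by (rule sum.cong) (simp_all add: T_def D_def algebra_simps)
    finally show ?thesis .
  qed
  have sgn: "((-1) ^ m * f) $ j = (-1) ^ m * f $ j" for f :: "real fps" and m j
    by (cases "even m") auto
  have Tj: "T p $ j = 0" if "p \<in> {1..s}" "j < k" for p j
    using that less[of "s - p"] P
    by (auto simp: T_def sgn fps_mult_nth Q D_def intro!: sum.neutral)
  \<comment> \<open>a product with a factor that vanishes below \<open>t ^ k\<close> only sees the constant term of the other factor\<close>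
  have Tk: "T p $ k = (-1) ^ (p - 1) * (moser_poly (s - p) k ?n * real ?n + real p ^ k * real (?n choose (s - p))) * c"
    if p: "p \<in> {1..s}" for p
  proof -
    have D: "D (s - p) $ j = 0" if "j < k" for j using less[of "s - p"] p that by (auto simp: D_def)
    have Dk: "D (s - p) $ k = moser_poly (s - p) k ?n * c" using less[of "s - p"] p by (auto simp: D_def c_def)
    have "(D (s - p) * Q x p) $ k = (\<Sum>j\<in>{k}. D (s - p) $ j * Q x p $ (k - j))"
      unfolding fps_mult_nth by (rule sum.mono_neutral_right) (auto simp: D)
    then have 1: "(D (s - p) * Q x p) $ k = moser_poly (s - p) k ?n * c * real ?n"
      by (simp add: Dk Q)
    have "(esym A ?Y (s - p) * (Q x p - Q y p)) $ k = (\<Sum>j\<in>{0}. esym A ?Y (s - p) $ j * (Q x p - Q y p) $ (k - j))"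
      unfolding fps_mult_nth by (rule sum.mono_neutral_right) (auto simp: Q P)
    then have 2: "(esym A ?Y (s - p) * (Q x p - Q y p)) $ k = real (?n choose (s - p)) * (real p ^ k * c)"
      by (simp add: Y0 Q c_def diff_divide_distrib right_diff_distrib)
    show ?thesis unfolding T_def sgn fps_add_nth 1 2 by (simp add: algebra_simps)
  qed
  have nth: "real s * D s $ j = (\<Sum>p=1..s. T p $ j)" for j
    using arg_cong[OF DT, of "\<lambda>f. f $ j"] by (simp add: fps_sum_nth fps_of_nat[symmetric])
  have "real s * D s $ k = (\<Sum>p=1..s. (-1) ^ (p - 1) * (moser_poly (s - p) k ?n * real ?n + real p ^ k * real (?n choose (s - p)))) * c"
    unfolding nth sum_distrib_right by (rule sum.cong) (auto simp: Tk)
  also have "(\<Sum>p=1..s. (-1) ^ (p - 1) * (moser_poly (s - p) k ?n * real ?n + real p ^ k * real (?n choose (s - p))))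
      = of_int (int s * moser_poly s k ?n)"
    unfolding moser_poly_newton[OF \<open>k \<ge> 1\<close>] by (simp add: mult.commute)
  finally have k: "real s * D s $ k = real s * (moser_poly s k ?n * c)" by simp
  have j: "real s * D s $ j = 0" if "j < k" for j unfolding nth using that by (simp add: Tj)
  show ?case
  proof (cases "s = 0")
    case True
    then show ?thesis using \<open>finite A\<close> by (simp add: moser_poly_def)
  next
    case False
    then have "D s $ k = moser_poly s k ?n * c" "\<And>j. j < k \<Longrightarrow> D s $ j = 0" using k j by auto
    then show ?thesis unfolding D_def c_def by blast
  qed
qed

text \<open>
Strong induction on the exponent: the previous lemma shows that the \<open>k\<close>-th power sums agree once the
lower ones do.
\<close>

lemma subset_sums_determine_multiset:
  fixes x y :: "'i \<Rightarrow> real"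
  assumes "finite A" and F: "\<And>k. k \<in> {1..card A} \<Longrightarrow> moser_poly s k (card A) \<noteq> 0"
    and eq: "image_mset (\<lambda>I. \<Sum>i\<in>I. x i) (mset_set {I. I \<subseteq> A \<and> card I = s}) =
             image_mset (\<lambda>I. \<Sum>i\<in>I. y i) (mset_set {I. I \<subseteq> A \<and> card I = s})"
  shows "image_mset x (mset_set A) = image_mset y (mset_set A)"
proof (rule power_sums_determine_multiset[OF \<open>finite A\<close>])
  have "esym A (\<lambda>i. fps_exp (z i)) s =
      (\<Sum>v\<in>#image_mset (\<lambda>I. \<Sum>i\<in>I. z i) (mset_set {I. I \<subseteq> A \<and> card I = s}). fps_exp v)" for z :: "'i \<Rightarrow> real"
    by (simp add: esym_fps_exp sum_unfold_sum_mset multiset.map_comp o_def)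
  then have e: "esym A (\<lambda>i. fps_exp (x i)) s = esym A (\<lambda>i. fps_exp (y i)) s" by (simp add: eq)
  fix k assume "k \<in> {1..card A}"
  then show "(\<Sum>i\<in>A. x i ^ k) = (\<Sum>i\<in>A. y i ^ k)"
  proof (induction k rule: less_induct)
    case (less k)
    have "(\<Sum>i\<in>A. x i ^ j) = (\<Sum>i\<in>A. y i ^ j)" if "j < k" for j
      using less that by (cases "j = 0") auto
    from esym_fps_exp_first_difference[OF \<open>finite A\<close> _ this, of k s] less.prems
    have "moser_poly s k (card A) * (((\<Sum>i\<in>A. x i ^ k) - (\<Sum>i\<in>A. y i ^ k)) / fact k) = 0"
      by (simp add: e)
    then show ?case using F[OF less.prems] by simp
  qed
qed

text \<open>
Logarithms of the parts reduce this to \<open>subset_sums_determine_multiset\<close>; a weakly decreasing list is determined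
by its multiset of entries.
\<close>

theorem inj_on_pre:
  assumes F: "\<And>k. k \<in> {1..n} \<Longrightarrow> moser_poly s k n \<noteq> 0"
  shows "inj_on (pre s) (partitions_of_length n)"
proof (rule inj_onI)
  fix xs ys assume xs: "xs \<in> partitions_of_length n" and ys: "ys \<in> partitions_of_length n"
    and eq: "pre s xs = pre s ys"
  define S where "S = {I. I \<subseteq> {..<n} \<and> card I = s}"
  have ln_pre: "image_mset (\<lambda>v. ln (real v)) (pre s zs) = image_mset (\<lambda>I. \<Sum>i\<in>I. ln (real (zs ! i))) (mset_set S)"
    if zs: "zs \<in> partitions_of_length n" for zs
  proof -
    have "ln (real (\<Prod>i\<in>I. zs ! i)) = (\<Sum>i\<in>I. ln (real (zs ! i)))" if "I \<in> S" for I
    proof -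
      have "finite I" "\<And>i. i \<in> I \<Longrightarrow> 0 < zs ! i"
        using that zs by (auto simp: S_def partitions_of_length_def dest: finite_subset)
      then show ?thesis by (simp add: ln_prod)
    qed
    moreover have "finite S" by (simp add: S_def)
    moreover have "length zs = n" using zs by (simp add: partitions_of_length_def)
    ultimately show ?thesis unfolding pre_def multiset.map_comp
      by (auto intro!: image_mset_cong simp: S_def)
  qed
  have "image_mset (\<lambda>i. ln (real (xs ! i))) (mset_set {..<n}) = image_mset (\<lambda>i. ln (real (ys ! i))) (mset_set {..<n})"
  proof (rule subset_sums_determine_multiset)
    show "image_mset (\<lambda>I. \<Sum>i\<in>I. ln (real (xs ! i))) (mset_set {I. I \<subseteq> {..<n} \<and> card I = s}) =
      image_mset (\<lambda>I. \<Sum>i\<in>I. ln (real (ys ! i))) (mset_set {I. I \<subseteq> {..<n} \<and> card I = s})"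
      using ln_pre[OF xs] ln_pre[OF ys] eq by (simp add: S_def)
  qed (use F in auto)
  then have "image_mset (\<lambda>v. nat \<lfloor>exp v\<rfloor>) (image_mset (\<lambda>i. ln (real (xs ! i))) (mset_set {..<n})) =
      image_mset (\<lambda>v. nat \<lfloor>exp v\<rfloor>) (image_mset (\<lambda>i. ln (real (ys ! i))) (mset_set {..<n}))" by simp
  moreover have "image_mset (\<lambda>v. nat \<lfloor>exp v\<rfloor>) (image_mset (\<lambda>i. ln (real (zs ! i))) (mset_set {..<n})) = mset zs"
    if zs: "zs \<in> partitions_of_length n" for zs
  proof -
    have "image_mset (\<lambda>v. nat \<lfloor>exp v\<rfloor>) (image_mset (\<lambda>i. ln (real (zs ! i))) (mset_set {..<n})) =
      image_mset (\<lambda>i. zs ! i) (mset_set {..<n})"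
      unfolding multiset.map_comp
      by (rule image_mset_cong) (use zs in \<open>auto simp: partitions_of_length_def\<close>)
    also have "\<dots> = mset (map ((!) zs) [0..<length zs])"
      using zs by (simp add: partitions_of_length_def lessThan_atLeast0)
    finally show ?thesis by (simp add: map_nth)
  qed
  ultimately have "mset (rev xs) = mset (rev ys)" using xs ys by simp
  moreover have "sorted (rev xs)" "sorted (rev ys)"
    using xs ys by (simp_all add: partitions_of_length_def sorted_wrt_rev)
  ultimately show "xs = ys" by (metis properties_for_sort rev_rev_ident)
qed

section \<open>Zeros of the Moser polynomials for subsets of size 3 and 4\<close>

lemma int_binomial_Suc: "int (Suc j) * int (n choose Suc j) = (int n - int j) * int (n choose j)"
proof (cases "j \<le> n")
  case True
  have "Suc j * (n choose Suc j) = (n - j) * (n choose j)"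
    using binomial_absorb_comp[of n j] binomial_absorption[of j n] by simp
  then show ?thesis using True by (metis of_nat_diff of_nat_mult)
qed (simp add: binomial_eq_0)

lemma int_binomials:
  "2 * int (n choose 2) = int n * (int n - 1)"
  "6 * int (n choose 3) = int n * (int n - 1) * (int n - 2)"
  "24 * int (n choose 4) = int n * (int n - 1) * (int n - 2) * (int n - 3)"
proof -
  have S: "Suc 1 = 2" "Suc 2 = 3" "Suc 3 = 4" by simp_all
  have 2: "2 * int (n choose 2) = (int n - 1) * int n"
    using int_binomial_Suc[of 1 n] unfolding S by simp
  have 3: "3 * int (n choose 3) = (int n - 2) * int (n choose 2)"
    using int_binomial_Suc[of 2 n] unfolding S by simp
  have 4: "4 * int (n choose 4) = (int n - 3) * int (n choose 3)"
    using int_binomial_Suc[of 3 n] unfolding S by simp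
  have c2: "2 * int (n choose 2) = int n * (int n - 1)"
    unfolding 2 by (rule mult.commute)
  have "6 * int (n choose 3) = (int n - 2) * (2 * int (n choose 2))" using 3 by simp
  then have c3: "6 * int (n choose 3) = int n * (int n - 1) * (int n - 2)"
    unfolding c2 by (simp only: mult.commute mult.left_commute)
  have "24 * int (n choose 4) = (int n - 3) * (6 * int (n choose 3))" using 4 by simp
  then have c4: "24 * int (n choose 4) = int n * (int n - 1) * (int n - 2) * (int n - 3)"
    unfolding c3 by (simp only: mult.commute mult.left_commute)
  show "2 * int (n choose 2) = int n * (int n - 1)"
    and "6 * int (n choose 3) = int n * (int n - 1) * (int n - 2)"
    and "24 * int (n choose 4) = int n * (int n - 1) * (int n - 2) * (int n - 3)"
    by (fact c2, fact c3, fact c4)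
qed

lemma moser_poly_3:
  "2 * moser_poly 3 (Suc e) n = int n * (int n - 1) - 2 * 2 ^ e * int n + 2 * 3 ^ e"
proof -
  have "{1..3} = {1, 2, 3::nat}" by auto
  then have "moser_poly 3 (Suc e) n = int (n choose 2) - 2 ^ e * int n + 3 ^ e"
    by (simp add: moser_poly_def)
  then show ?thesis using int_binomials(1)[of n] by simp
qed

lemma moser_poly_4:
  "6 * moser_poly 4 (Suc e) n =
     int n * (int n - 1) * (int n - 2) - 3 * 2 ^ e * int n * (int n - 1) + 6 * 3 ^ e * int n - 6 * 4 ^ e"
proof -
  have "{1..4} = {1, 2, 3, 4::nat}" by auto
  then have "moser_poly 4 (Suc e) n = int (n choose 3) - 2 ^ e * int (n choose 2) + 3 ^ e * int n - 4 ^ e"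
    by (simp add: moser_poly_def)
  then have "6 * moser_poly 4 (Suc e) n =
      6 * int (n choose 3) - 3 * 2 ^ e * (2 * int (n choose 2)) + 6 * 3 ^ e * int n - 6 * 4 ^ e"
    by simp
  then show ?thesis unfolding int_binomials by (simp add: algebra_simps)
qed

lemma moser_poly_5:
  "24 * moser_poly 5 (Suc e) n =
     int n * (int n - 1) * (int n - 2) * (int n - 3) - 4 * 2 ^ e * int n * (int n - 1) * (int n - 2)
     + 12 * 3 ^ e * int n * (int n - 1) - 24 * 4 ^ e * int n + 24 * 5 ^ e"
proof -
  have "{1..5} = {1, 2, 3, 4, 5::nat}" by auto
  then have "moser_poly 5 (Suc e) n =
      int (n choose 4) - 2 ^ e * int (n choose 3) + 3 ^ e * int (n choose 2) - 4 ^ e * int n + 5 ^ e"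
    by (simp add: moser_poly_def)
  then have "24 * moser_poly 5 (Suc e) n = 24 * int (n choose 4) - 4 * 2 ^ e * (6 * int (n choose 3))
      + 12 * 3 ^ e * (2 * int (n choose 2)) - 24 * 4 ^ e * int n + 24 * 5 ^ e"
    by simp
  then show ?thesis unfolding int_binomials by (simp add: algebra_simps)
qed

lemma dvd_mult_prime_powerE:
  fixes n :: nat
  assumes "n dvd c * p ^ e" "prime p"
  obtains d a where "n = d * p ^ a" "d dvd c" "a \<le> e"
proof -
  obtain d q where dq: "n = d * q" "d dvd c" "q dvd p ^ e"
    using division_decomp[OF assms(1)] by blast
  then obtain a where "a \<le> e" "q = p ^ a" using divides_primepow_nat[OF assms(2)] by blast
  with dq show thesis using that by blast
qed

lemma power_mod_period:
  fixes b m :: int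
  assumes "b ^ r mod m = 1 mod m"
  shows "b ^ e mod m = b ^ (e mod r) mod m"
proof -
  have "(b ^ r) ^ (e div r) mod m = 1 mod m"
    by (metis assms power_mod power_one)
  then have "((b ^ r) ^ (e div r) * b ^ (e mod r)) mod m = b ^ (e mod r) mod m"
    by (metis mod_mult_left_eq mult_1)
  then show ?thesis by (metis div_mult_mod_eq power_add power_mult mult.commute)
qed

text \<open>
Lifting the exponent. The hypothesis for \<open>c + 1\<close> contains \<open>9 dvd 2 ^ k + 1\<close>, which forces \<open>k = 3 * l\<close>;
with \<open>x = 2 ^ l\<close> the factorisation \<open>x ^ 3 + 1 = (x + 1) * ((x + 1)\<^sup>2 - 3 * x)\<close> loses exactly one factor
3 in passing to \<open>x + 1\<close>.
\<close>

lemma three_power_dvd_two_power_plus_1: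
  assumes "3 ^ Suc c dvd (2 ^ k + 1 :: int)"
  shows "3 ^ c dvd k"
  using assms
proof (induction c arbitrary: k)
  case (Suc c)
  have "3 dvd k"
  proof -
    have "(9::int) dvd 3 ^ Suc (Suc c)" by simp
    then have "9 dvd (2 ^ k + 1 :: int)" using Suc.prems dvd_trans by blast
    then have "(2 ^ k mod 9 + 1 :: int) mod 9 = 0" by presburger
    then have "(2 ^ (k mod 6) mod 9 + 1 :: int) mod 9 = 0"
      by (subst (asm) power_mod_period[of 2 6 9]) simp_all
    moreover have "k mod 6 \<in> {0,1,2,3,4,5}" by auto
    ultimately have "k mod 6 = 3" by auto
    then show ?thesis by presburger
  qed
  then obtain l where k: "k = 3 * l" by blast
  define x :: int where "x = 2 ^ l"
  have "2 ^ k = x ^ 3" unfolding x_def k by (simp add: power_mult mult.commute[of 3])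
  then have x: "2 ^ k + 1 = (x + 1) * ((x + 1)\<^sup>2 - 3 * x)"
    by (simp add: power2_eq_square power3_eq_cube algebra_simps)
  have "(3::int) dvd 3 ^ Suc (Suc c)" by simp
  then have "3 dvd (x + 1) * ((x + 1)\<^sup>2 - 3 * x)" using Suc.prems x dvd_trans by metis
  then have "3 dvd x + 1 \<or> 3 dvd (x + 1)\<^sup>2"
    by (simp add: prime_dvd_mult_iff dvd_diff_left_iff)
  then have "3 dvd x + 1" by (simp add: prime_dvd_power_iff)
  then obtain w where w: "x + 1 = 3 * w" by blast
  have "\<not> 3 dvd x" using w by presburger
  then have "coprime 3 (3 * w\<^sup>2 - x)" by (simp add: prime_imp_coprime dvd_diff_right_iff)
  moreover have "3 ^ Suc (Suc c) dvd 3 ^ 2 * (w * (3 * w\<^sup>2 - x))"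
    using Suc.prems unfolding x w by (simp add: power2_eq_square algebra_simps)
  then have "3 ^ c dvd w * (3 * w\<^sup>2 - x)" by simp
  ultimately have "3 ^ c dvd w" by (simp add: coprime_dvd_mult_left_iff)
  then have "3 ^ Suc c dvd x + 1" using w by simp
  then show ?case using Suc.IH[of l] by (simp add: x_def k)
qed simp

text \<open>
The larger exponent \<open>M\<close> satisfies \<open>3 ^ M \<le> 2 ^ (a + b + 1)\<close>, so it is at most about
\<open>2 / 3 * (a + b)\<close> (from \<open>2^3 < 3^2\<close>), and the smaller one, \<open>c\<close>, is at least about a third of
\<open>a + b\<close>. But \<open>3 ^ c\<close> divides \<open>2 ^ (a + b + 1) + 1\<close>, so \<open>3 ^ (c - 1) \<le> a + b + 1\<close>; this fails as soon as
\<open>a + b \<ge> 14\<close>.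
\<close>

lemma three_powers_eq_two_power_plus_1:
  assumes eq: "3 ^ a + 2 * 3 ^ b = (2 ^ Suc (a + b) + 1 :: nat)"
  shows "(a, b) \<in> {(0, 0), (1, 0), (1, 1), (3, 1), (3, 5)}"
proof -
  define c M where "c = min a b" and "M = max a b"
  have e: "a + b = c + M" by (simp add: c_def M_def)
  have "3 ^ a \<le> (2::nat) ^ Suc (a + b)" "3 ^ b \<le> (2::nat) ^ Suc (a + b)"
    using eq one_le_power[of "3::nat" a] one_le_power[of "3::nat" b] by linarith+
  then have "3 ^ M \<le> (2::nat) ^ Suc (a + b)" by (simp add: M_def max_def)
  then have "(3 ^ M) ^ 3 \<le> ((2::nat) ^ Suc (a + b)) ^ 3" by (rule power_mono) simp
  also have "\<dots> = (2 ^ 3) ^ Suc (a + b)" by (simp only: power_mult[symmetric] mult.commute)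
  also have "\<dots> < 9 ^ Suc (a + b)" by (rule power_strict_mono) auto
  also have "\<dots> = 3 ^ (2 * Suc (a + b))" by (subst power_mult) simp
  finally have "(3::nat) ^ (M * 3) < 3 ^ (2 * Suc (a + b))" by (simp only: power_mult)
  then have M: "M * 3 < 2 * Suc (a + b)" by (rule power_less_imp_less_exp[rotated]) simp
  have "a + b \<le> 13"
  proof (rule ccontr)
    assume "\<not> a + b \<le> 13"
    with M e have c: "c \<ge> 5" "a + b \<le> 3 * c + 1" by auto
    then obtain c' where c': "c = Suc c'" "c' \<ge> 4" by (cases c) auto
    have "3 ^ c dvd (3::int) ^ a + 2 * 3 ^ b"
      by (intro dvd_add dvd_mult le_imp_power_dvd) (auto simp: c_def)
    also have "(3::int) ^ a + 2 * 3 ^ b = 2 ^ Suc (a + b) + 1"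
      using arg_cong[OF eq, of int] by simp
    finally have "3 ^ c' dvd Suc (a + b)" unfolding c' by (rule three_power_dvd_two_power_plus_1)
    then have "3 ^ c' \<le> Suc (a + b)" by (rule dvd_imp_le) simp
    also have "\<dots> \<le> 3 * c' + 5" using c c' by simp
    also have "\<dots> < 3 ^ c'" using c'(2) by (induction c' rule: dec_induct) auto
    finally show False by simp
  qed
  moreover have "list_all (\<lambda>a. list_all (\<lambda>b. 3 ^ a + 2 * 3 ^ b = (2 ^ Suc (a + b) + 1 :: int) \<longrightarrow>
      (a, b) \<in> {(0, 0), (1, 0), (1, 1), (3, 1), (3, 5)}) [0..<14]) [0..<14]"
    by code_simp
  moreover have "3 ^ a + 2 * 3 ^ b = (2 ^ Suc (a + b) + 1 :: int)"
    using arg_cong[OF eq, of int] by simp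
  ultimately show ?thesis by (auto simp: list_all_iff)
qed

text \<open>
As a polynomial in \<open>n\<close>, \<open>moser_poly 3 k n\<close> is quadratic; its second root \<open>m\<close> satisfies
\<open>n + m = 2 ^ k + 1\<close> and \<open>n * m = 2 * 3 ^ (k - 1)\<close>. The exceptional \<open>n\<close> are the entries
\<open>3 ^ a\<close> and \<open>2 * 3 ^ b\<close> exceeding 3 in the five solutions above.
\<close>

lemma moser_poly_3_nonzero:
  assumes n: "n > 3" "n \<notin> {6, 27, 486}" and "k \<ge> 1"
  shows "moser_poly 3 k n \<noteq> 0"
proof
  assume zero: "moser_poly 3 k n = 0"
  obtain e where k: "k = Suc e" using \<open>k \<ge> 1\<close> by (cases k) auto
  have prod: "int n * (2 ^ Suc e + 1 - int n) = 2 * 3 ^ e"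
    using moser_poly_3[of e n] zero by (simp add: k algebra_simps)
  then have "0 < int n * (2 ^ Suc e + 1 - int n)" by simp
  then have "0 < 2 ^ Suc e + 1 - int n" using n by (simp add: zero_less_mult_iff)
  then obtain m where m: "2 ^ Suc e + 1 - int n = int m" by (metis zero_le_imp_eq_int order_less_imp_le)
  then have "int (n * m) = int (2 * 3 ^ e)" using prod by simp
  then have nm: "n * m = 2 * 3 ^ e" by (simp only: of_nat_eq_iff)
  have "int (n + m) = int (2 ^ Suc e + 1)" using m by simp
  then have sum: "n + m = 2 ^ Suc e + 1" by (simp only: of_nat_eq_iff)
  obtain d a where na: "n = d * 3 ^ a" "d dvd 2" "a \<le> e"
    by (rule dvd_mult_prime_powerE[of n 2 3 e]) (auto simp: nm[symmetric])
  define b where "b = e - a"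
  have e: "e = a + b" using na by (simp add: b_def)
  have "d = 1 \<or> d = 2" using \<open>d dvd 2\<close> by (metis two_is_prime_nat prime_nat_iff)
  then show False
  proof
    assume "d = 1"
    then have "m = 2 * 3 ^ b" using nm na e by (simp add: power_add)
    with sum na e \<open>d = 1\<close> have "3 ^ a + 2 * 3 ^ b = (2 ^ Suc (a + b) + 1 :: nat)" by simp
    from three_powers_eq_two_power_plus_1[OF this] n na \<open>d = 1\<close> show False by auto
  next
    assume "d = 2"
    then have "m = 3 ^ b" using nm na e by (simp add: power_add)
    with sum na e \<open>d = 2\<close> have "3 ^ b + 2 * 3 ^ a = (2 ^ Suc (b + a) + 1 :: nat)" by (simp add: add.commute)
    from three_powers_eq_two_power_plus_1[OF this] n na \<open>d = 2\<close> show False by auto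
  qed
qed

lemma dvd_24_cases:
  fixes d :: nat
  assumes "d dvd 24"
  shows "d \<in> {1, 2, 3, 4, 6, 8, 12, 24}"
proof -
  have "list_all (\<lambda>d. d dvd 24 \<longrightarrow> d \<in> {1, 2, 3, 4, 6, 8, 12, 24}) [0..24::int]" by code_simp
  moreover have "d \<le> 24" using assms by (rule dvd_imp_le) simp
  then have "int d \<in> set [0..24]" by simp
  moreover have "int d dvd 24" using assms by (metis of_nat_dvd_iff of_nat_numeral)
  ultimately have "int d \<in> {1, 2, 3, 4, 6, 8, 12, 24}" unfolding list_all_iff by blast
  then show ?thesis by auto
qed

text \<open>
Beyond its largest root, which is close to \<open>3 * 2 ^ e\<close>, the polynomial is positive.
\<close>

lemma moser_poly_4_pos:
  assumes "n \<ge> 3 * 2 ^ e + 2"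
  shows "moser_poly 4 (Suc e) n > 0"
proof -
  have n: "int n \<ge> 3 * 2 ^ e + 2" using of_nat_mono[OF assms, where 'a = int] by simp
  have "(4::int) ^ e \<le> 6 ^ e" by (rule power_mono) auto
  also have "\<dots> = 2 ^ e * 3 ^ e" by (simp flip: power_mult_distrib)
  also have "\<dots> < int n * 3 ^ e"
  proof (rule mult_strict_right_mono)
    show "2 ^ e < int n" using n one_le_power[of "2::int" e] by linarith
  qed simp
  finally have 1: "6 * 3 ^ e * int n - 6 * 4 ^ e > 0" by (simp add: mult.commute)
  have "0 \<le> int n * (int n - 1) * (int n - 2 - 3 * 2 ^ e)"
    using n one_le_power[of "2::int" e] by (intro mult_nonneg_nonneg) linarith+
  moreover have "6 * moser_poly 4 (Suc e) n =
      int n * (int n - 1) * (int n - 2 - 3 * 2 ^ e) + (6 * 3 ^ e * int n - 6 * 4 ^ e)"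
    unfolding moser_poly_4 by (simp add: algebra_simps)
  ultimately show ?thesis using 1 by linarith
qed

text \<open>
Write \<open>k = e + 1\<close> and \<open>n = d * 2 ^ i\<close> with \<open>d\<close> dividing 3. If \<open>n\<close>, \<open>2 ^ e\<close> and the cofactor \<open>B\<close> in \<open>n * B = 6 * 4 ^ e\<close> are all
divisible by 16, then \<open>2 + 6 * 3 ^ e\<close> is divisible by 16, which never happens. Otherwise
\<open>e\<close> or \<open>i\<close> is at most 3, or \<open>i\<close> is so close to its maximum \<open>2 * e + 1\<close> that \<open>n\<close> exceeds all roots.
\<close>

lemma moser_poly_4_nonzero:
  assumes n: "n > 4" "n \<notin> {8, 12}" and "k \<ge> 1"
  shows "moser_poly 4 k n \<noteq> 0"
proof
  assume zero: "moser_poly 4 k n = 0"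
  obtain e where k: "k = Suc e" using \<open>k \<ge> 1\<close> by (cases k) auto
  define B where "B = (int n - 1) * (int n - 2) - 3 * 2 ^ e * (int n - 1) + 6 * 3 ^ e"
  have E: "int n * B = 6 * 4 ^ e"
    using moser_poly_4[of e n] zero by (simp add: k B_def algebra_simps)
  have "(2::int) ^ (2 * e + 1) = 2 * 4 ^ e" by (simp add: power_mult)
  then have B: "int n * B = 3 * 2 ^ (2 * e + 1)" using E by simp
  then have "int n dvd int (3 * 2 ^ (2 * e + 1))" by (metis dvd_triv_left of_nat_mult of_nat_numeral of_nat_power)
  then have "n dvd 3 * 2 ^ (2 * e + 1)" by (simp only: of_nat_dvd_iff)
  then obtain d i where d: "n = d * 2 ^ i" "d dvd 3" "i \<le> 2 * e + 1"
    by (rule dvd_mult_prime_powerE) simp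
  have "d \<le> 3" using \<open>d dvd 3\<close> by (rule dvd_imp_le) simp
  then have "d = 0 \<or> d = 1 \<or> d = 2 \<or> d = 3" by auto
  then have d13: "d = 1 \<or> d = 3" using \<open>d dvd 3\<close> by auto
  have small: "\<not> (n < 3 * 2 ^ e + 2) \<Longrightarrow> False" using moser_poly_4_pos[of e n] zero k by auto
  consider "e \<le> 3" | "i \<le> 3" | "e > 3" "i > 3" "i \<ge> 2 * e - 2" | "e > 3" "i > 3" "i < 2 * e - 2"
    by linarith
  then show False
  proof cases
    case 1
    have "list_all (\<lambda>e. list_all (\<lambda>i. list_all (\<lambda>d. d * 2 ^ i \<le> 4 \<or> d * 2 ^ i = 8 \<or> d * 2 ^ i = 12 \<or>
        d * 2 ^ i * ((d * 2 ^ i - 1) * (d * 2 ^ i - 2) - 3 * 2 ^ e * (d * 2 ^ i - 1) + 6 * 3 ^ e) \<noteq> 6 * 4 ^ e)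
        [1, 3 :: int]) [0..<8]) [0..<4]"
      by code_simp
    moreover have "e \<in> set [0..<4]" "i \<in> set [0..<8]" "int d \<in> set [1, 3]" using 1 d(3) d13 by auto
    ultimately have "int n \<le> 4 \<or> int n = 8 \<or> int n = 12 \<or> int n * B \<noteq> 6 * 4 ^ e"
      unfolding list_all_iff B_def d(1) of_nat_mult of_nat_power of_nat_numeral by blast
    then show False using E n by simp
  next
    case 2
    have "i = 0 \<or> i = 1 \<or> i = 2 \<or> i = 3" using 2 by auto
    then consider "n = 6" | "n = 24" using d13 n unfolding d(1) by auto
    then show False
    proof cases
      case 1
      have E6: "20 - 15 * 2 ^ e + 6 * 3 ^ e = (4::int) ^ e" using E 1 unfolding B_def by simp
      consider "e = 0" | "e = 1" | f where "e = f + 2"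
        by (metis One_nat_def add_2_eq_Suc' not0_implies_Suc)
      then show False
      proof cases
        case (3 f)
        have "20 - 60 * 2 ^ f + 54 * 3 ^ f = 16 * (4::int) ^ f" using E6 3 by (simp add: power_add)
        moreover have "odd ((3::int) ^ f)" by simp
        moreover have "20 - 60 * x + 54 * y \<noteq> 16 * z" if "odd y" for x y z :: int
          using that by presburger
        ultimately show False by blast
      qed (use E6 in simp_all)
    next
      case 2
      have "(4::int) ^ e mod 3 = 1" using power_mod[of "4::int" 3 e] by simp
      moreover have "2024 - 276 * 2 ^ e + 24 * 3 ^ e = (4::int) ^ e" using E 2 unfolding B_def by simp
      moreover have "2024 - 276 * x + 24 * y \<noteq> z" if "z mod 3 = 1" for x y z :: int
        using that by presburger
      ultimately show False by blast
    qed
  next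
    case 3
    then obtain f where f: "e = f + 4" using le_Suc_ex[of 4 e] by (auto simp: add.commute)
    have "3 * 2 ^ e + 2 \<le> 64 * (2::nat) ^ f" using one_le_power[of "2::nat" f] by (simp add: f power_add)
    also have "\<dots> \<le> 64 * 4 ^ f" by (intro mult_left_mono power_mono) auto
    also have "\<dots> = 2 ^ (2 * e - 2)" by (simp add: f power_add power_mult)
    also have "\<dots> \<le> 2 ^ i" using 3 by (intro power_increasing) auto
    also have "\<dots> \<le> n" using d13 by (auto simp: d(1))
    finally show False using small by simp
  next
    case 4
    obtain f where f: "e = f + 4" using 4 le_Suc_ex[of 4 e] by (auto simp: add.commute)
    obtain h where h: "i = h + 4" using 4 le_Suc_ex[of 4 i] by (auto simp: add.commute)
    have "4 + i \<le> 2 * e + 1" using 4 by linarith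
    then obtain g where g: "2 * e + 1 = 4 + i + g" using le_Suc_ex by blast
    have "int d * B = 48 * 2 ^ g"
      using B unfolding d(1) g by (simp add: power_add)
    then have "16 dvd B" using d13 by auto
    then obtain q where "B = 16 * q" by blast
    moreover have "3 ^ e mod 8 = (3::int) \<or> 3 ^ e mod 8 = (1::int)"
    proof -
      have "3 ^ e mod 8 = 3 ^ (e mod 2) mod (8::int)" by (rule power_mod_period) simp
      moreover have "e mod 2 = 0 \<or> e mod 2 = 1" by auto
      ultimately show ?thesis by auto
    qed
    moreover have "B = 16 * (16 * (int d * 2 ^ h)\<^sup>2 - 3 * (int d * 2 ^ h) - 3 * 2 ^ f * (int n - 1)) + 2 + 6 * 3 ^ e"
      unfolding B_def f d(1) h by (simp add: power_add algebra_simps power2_eq_square)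
    moreover have "16 * q \<noteq> 16 * x + 2 + 6 * y" if "y mod 8 = 3 \<or> y mod 8 = 1" for q x y :: int
      using that by presburger
    ultimately show False by metis
  qed
qed

section \<open>Zeros of the Moser polynomials for subsets of size 5\<close>

text \<open>
This is \<open>24 * moser_poly 5 (Suc e) n\<close> for \<open>x2 = 2 ^ e\<close>, \<open>x3 = 3 ^ e\<close>, \<open>x4 = 4 ^ e\<close>, \<open>x5 = 5 ^ e\<close>. The powers
are separate arguments so that they can be replaced by residues; the Horner form keeps the
intermediate values of these evaluations small.
\<close>

definition moser_quartic :: "int \<Rightarrow> int \<Rightarrow> int \<Rightarrow> int \<Rightarrow> int \<Rightarrow> int" where
  "moser_quartic n x2 x3 x4 x5 =
     n * ((n - 1) * ((n - 2) * (n - 3 - 4 * x2) + 12 * x3) - 24 * x4) + 24 * x5"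

text \<open>
The pairs \<open>(d, a)\<close> for which \<open>n = d * 5 ^ a\<close> is a zero modulo \<open>q\<close>. The residues of the powers are
arguments, so that symbolic evaluation computes each of them once and not again for every pair.
\<close>

definition sieve_step :: "int \<Rightarrow> int \<Rightarrow> int \<Rightarrow> int \<Rightarrow> int \<Rightarrow> (int \<times> nat) list \<Rightarrow> (int \<times> nat) list" where
  "sieve_step q x2 x3 x4 x5 = filter (\<lambda>(d, a). moser_quartic (d * 5 ^ a mod q) x2 x3 x4 x5 mod q = 0)"

text \<open>
The numbers \<open>r2, r3, r4, r5\<close> are periods of the powers of 2, 3, 4, 5 modulo \<open>q\<close>; giving the smallest ones
keeps the powers short.
\<close>

definition sieve :: "int \<Rightarrow> nat \<times> nat \<times> nat \<times> nat \<Rightarrow> nat \<Rightarrow> (int \<times> nat) list \<Rightarrow> (int \<times> nat) list" where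
  "sieve q = (\<lambda>(r2, r3, r4, r5) e. sieve_step q (2 ^ (e mod r2) mod q) (3 ^ (e mod r3) mod q)
     (4 ^ (e mod r4) mod q) (5 ^ (e mod r5) mod q))"

definition divisors_24 :: "int list" where
  "divisors_24 = [1, 2, 3, 4, 6, 8, 12, 24]"

text \<open>
The case \<open>a \<le> 3\<close>, where \<open>n\<close> takes 26 values. The modulus is \<open>7 * 13 * 19 * 37\<close>, the product of the primes
other than 2, 3 and 5 whose predecessor divides 36; no zero survives for any \<open>e\<close> modulo 36.
\<close>

lemma sieve_small:
  "list_all (\<lambda>e. sieve 63973 (36, 36, 36, 36) e (filter (\<lambda>(d, a). d * 5 ^ a > 5 \<and> d * 5 ^ a \<noteq> 10)
     (List.product divisors_24 [0..<4])) = []) [0..<36]"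
  by code_simp

text \<open>
In the next two lemmas the values of \<open>e\<close> are the twelve classes modulo 500 of
\<open>moser_exponents_mod_500\<close>, which fall into four classes modulo 100. Modulo 101 the powers of 2, 3, 4, 5
depend on \<open>e\<close> modulo 100, and \<open>5 ^ a\<close> on \<open>a\<close> modulo 25. The few survivors are passed on to the modulus 251,
where 5 again has order 25, so that the same pairs \<open>(d, a)\<close> can be tested.
\<close>

lemma sieve_101:
  "sieve 101 (100, 100, 50, 25) 24 (List.product divisors_24 [0..<25]) =
     [(1, 5), (1, 20), (2, 6), (3, 24), (8, 0), (12, 18), (24, 2), (24, 17)]"
  "sieve 101 (100, 100, 50, 25) 31 (List.product divisors_24 [0..<25]) = [(2, 5), (3, 23)]"
  "sieve 101 (100, 100, 50, 25) 72 (List.product divisors_24 [0..<25]) = [(2, 19), (3, 12), (8, 10), (12, 3)]"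
  "sieve 101 (100, 100, 50, 25) 74 (List.product divisors_24 [0..<25]) = [(4, 22), (6, 15), (8, 9), (12, 2)]"
  by code_simp+

lemma sieve_251:
  "list_all (\<lambda>e. sieve 251 (50, 125, 25, 25) e [(1, 5), (1, 20), (2, 6), (3, 24), (8, 0), (12, 18), (24, 2), (24, 17)] = [])
     [24, 124, 224, 324, 424]"
  "list_all (\<lambda>e. sieve 251 (50, 125, 25, 25) e [(2, 5), (3, 23)] = []) [31]"
  "list_all (\<lambda>e. sieve 251 (50, 125, 25, 25) e [(2, 19), (3, 12), (8, 10), (12, 3)] = []) [72, 172, 272, 372, 472]"
  "list_all (\<lambda>e. sieve 251 (50, 125, 25, 25) e [(4, 22), (6, 15), (8, 9), (12, 2)] = []) [374]"
  by code_simp+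

text \<open>
The powers of 2, 3, 4 have period 100 modulo 125 and period 500 modulo 625. The classes
modulo 500 are found by lifting the classes modulo 100, as
\<open>b ^ (r + 100 * t) = b ^ r * (b ^ 100) ^ t\<close>, which keeps the numbers in the computation small.
\<close>

lemma moser_exponents_mod_500:
  fixes e :: nat
  assumes "625 dvd (3 + 4 * 2 ^ e + 6 * 3 ^ e + 12 * 4 ^ e :: int)"
  shows "e mod 500 \<in> {24, 31, 72, 124, 172, 224, 272, 324, 372, 374, 424, 472}"
proof -
  have cong: "(3 + 4 * x + 6 * y + 12 * z) mod m = (3 + 4 * x' + 6 * y' + 12 * z') mod m"
    if "x mod m = x' mod m" "y mod m = y' mod m" "z mod m = z' mod m" for x y z x' y' z' m :: int
    by (intro mod_add_cong mod_mult_cong refl that)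
  \<comment> \<open>\<open>r\<close> is the class modulo 100 and \<open>t\<close> selects its lift to a class modulo 500\<close>
  define r t where "r = e mod 100" and "t = e div 100 mod 5"
  have e: "e mod 500 = r + 100 * t" using mod_mult2_eq[of e 100 5] by (simp add: r_def t_def)
  have "125 dvd (3 + 4 * 2 ^ e + 6 * 3 ^ e + 12 * 4 ^ e :: int)"
    by (rule dvd_trans[OF _ assms]) simp
  then have "(3 + 4 * 2 ^ e + 6 * 3 ^ e + 12 * 4 ^ e) mod 125 = (0 :: int)" by (rule dvd_imp_mod_0)
  then have r125: "(3 + 4 * 2 ^ r + 6 * 3 ^ r + 12 * 4 ^ r) mod 125 = (0 :: int)"
    unfolding r_def by (subst cong[OF power_mod_period[symmetric] power_mod_period[symmetric] power_mod_period[symmetric]]) simp_all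
  have "list_all (\<lambda>r. (3 + 4 * 2 ^ r + 6 * 3 ^ r + 12 * 4 ^ r) mod 125 = (0 :: int) \<longrightarrow>
      List.member [4, 12, 24, 31, 32, 44, 52, 64, 72, 74, 84, 92] r) [0..<100]"
    by code_simp
  then have "\<forall>r\<in>set [0..<100]. (3 + 4 * 2 ^ r + 6 * 3 ^ r + 12 * 4 ^ r) mod 125 = (0 :: int) \<longrightarrow>
      r \<in> set [4, 12, 24, 31, 32, 44, 52, 64, 72, 74, 84, 92]"
    unfolding list_all_iff List.member_iff .
  note bspec[OF this, of r]
  then have r: "r \<in> set [4, 12, 24, 31, 32, 44, 52, 64, 72, 74, 84, 92]"
    using r125 by (simp add: r_def del: set_simps)
  have lift: "b ^ e mod 625 = b ^ r * c ^ t mod 625"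
    if c: "b ^ 100 mod 625 = c" "c ^ 5 mod 625 = 1" for b c :: int
  proof -
    have pow: "(b ^ 100) ^ i mod 625 = c ^ i mod 625" for i
      unfolding c(1)[symmetric] by (rule power_mod[symmetric])
    have "b ^ 500 mod 625 = 1 mod 625" using pow[of 5] c(2) by (simp flip: power_mult)
    then have "b ^ e mod 625 = b ^ (r + 100 * t) mod 625" unfolding e[symmetric] by (rule power_mod_period)
    also have "\<dots> = b ^ r * (b ^ 100) ^ t mod 625" by (simp only: power_add power_mult)
    also have "\<dots> = b ^ r * c ^ t mod 625" by (rule mod_mult_cong[OF refl pow])
    finally show ?thesis .
  qed
  have lifts: "2 ^ e mod 625 = 2 ^ r * 376 ^ t mod (625 :: int)" "3 ^ e mod 625 = 3 ^ r * 126 ^ t mod (625 :: int)"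
    "4 ^ e mod 625 = 4 ^ r * 126 ^ t mod (625 :: int)"
    by (rule lift, simp, simp)+
  have "(3 + 4 * 2 ^ e + 6 * 3 ^ e + 12 * 4 ^ e) mod 625 = (0 :: int)" using assms by (rule dvd_imp_mod_0)
  then have e625: "(3 + 4 * (2 ^ r * 376 ^ t) + 6 * (3 ^ r * 126 ^ t) + 12 * (4 ^ r * 126 ^ t)) mod 625 = (0 :: int)"
    by (subst cong[OF lifts[symmetric]])
  have "list_all (\<lambda>r. list_all (\<lambda>t.
      (3 + 4 * (2 ^ r * 376 ^ t) + 6 * (3 ^ r * 126 ^ t) + 12 * (4 ^ r * 126 ^ t)) mod 625 = (0 :: int) \<longrightarrow>
      List.member [24, 31, 72, 124, 172, 224, 272, 324, 372, 374, 424, 472] (r + 100 * t)) [0..<5])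
      [4, 12, 24, 31, 32, 44, 52, 64, 72, 74, 84, 92]"
    by code_simp
  then have "\<forall>r\<in>set [4, 12, 24, 31, 32, 44, 52, 64, 72, 74, 84, 92]. \<forall>t\<in>set [0..<5].
      (3 + 4 * (2 ^ r * 376 ^ t) + 6 * (3 ^ r * 126 ^ t) + 12 * (4 ^ r * 126 ^ t)) mod 625 = (0 :: int) \<longrightarrow>
      r + 100 * t \<in> set [24, 31, 72, 124, 172, 224, 272, 324, 372, 374, 424, 472]"
    unfolding list_all_iff List.member_iff .
  then have "\<forall>t\<in>set [0..<5].
      (3 + 4 * (2 ^ r * 376 ^ t) + 6 * (3 ^ r * 126 ^ t) + 12 * (4 ^ r * 126 ^ t)) mod 625 = (0 :: int) \<longrightarrow>
      r + 100 * t \<in> set [24, 31, 72, 124, 172, 224, 272, 324, 372, 374, 424, 472]"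
    using r by (rule bspec)
  note bspec[OF this, of t]
  then have "e mod 500 \<in> set [24, 31, 72, 124, 172, 224, 272, 324, 372, 374, 424, 472]"
    using e625 by (simp add: t_def e del: set_simps)
  then show ?thesis by simp
qed

lemma moser_quartic_cong:
  assumes "n mod q = n' mod q" "x2 mod q = x2' mod q" "x3 mod q = x3' mod q" "x4 mod q = x4' mod q" "x5 mod q = x5' mod q"
  shows "moser_quartic n x2 x3 x4 x5 mod q = moser_quartic n' x2' x3' x4' x5' mod q"
  unfolding moser_quartic_def
  by (intro mod_add_cong mod_diff_cong mod_mult_cong refl assms)

text \<open>
An integer zero is a zero modulo every \<open>q\<close>, so an empty sieve excludes it. The exponent \<open>a\<close> of 5 in \<open>n\<close> is reduced
modulo the same period \<open>r5\<close> as the exponent of 5 in the constant term.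
\<close>

lemma mem_sieve:
  assumes root: "moser_quartic (d * 5 ^ a) (2 ^ e) (3 ^ e) (4 ^ e) (5 ^ e) = 0"
    and per: "2 ^ r2 mod q = 1 mod q" "3 ^ r3 mod q = 1 mod q" "4 ^ r4 mod q = 1 mod q" "5 ^ r5 mod q = 1 mod q"
    and mem: "(d, a mod r5) \<in> set das"
  shows "(d, a mod r5) \<in> set (sieve q (r2, r3, r4, r5) e das)"
proof -
  have "moser_quartic (d * 5 ^ (a mod r5) mod q) (2 ^ (e mod r2) mod q) (3 ^ (e mod r3) mod q) (4 ^ (e mod r4) mod q)
      (5 ^ (e mod r5) mod q) mod q = moser_quartic (d * 5 ^ a) (2 ^ e) (3 ^ e) (4 ^ e) (5 ^ e) mod q"
    unfolding power_mod_period[OF per(1), symmetric] power_mod_period[OF per(2), symmetric]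
      power_mod_period[OF per(3), symmetric] power_mod_period[OF per(4), symmetric]
    by (rule moser_quartic_cong) (simp_all, metis mod_mult_right_eq power_mod_period[OF per(4)])
  then show ?thesis using mem root by (simp add: sieve_def sieve_step_def)
qed

lemma sieve_mod:
  assumes "r2 dvd r" "r3 dvd r" "r4 dvd r" "r5 dvd r"
  shows "sieve q (r2, r3, r4, r5) (e mod r) = sieve q (r2, r3, r4, r5) e"
  using assms by (simp add: sieve_def mod_mod_cancel)

text \<open>
Beyond its largest root, which is close to \<open>4 * 2 ^ e\<close>, the quartic is positive.
\<close>

lemma moser_quartic_pos:
  assumes "n \<ge> 4 * 2 ^ e + 3"
  shows "moser_quartic n (2 ^ e) (3 ^ e) (4 ^ e) (5 ^ e) > 0"
proof -
  have n: "n > 0" "n - 1 \<ge> 2 * 2 ^ e" and nn: "0 \<le> n - 2" "0 \<le> n - 3 - 4 * 2 ^ e"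
    using assms one_le_power[of "2::int" e] by linarith+
  have "(4::int) ^ e \<le> 6 ^ e" by (rule power_mono) auto
  also have "\<dots> = 2 ^ e * 3 ^ e" by (simp flip: power_mult_distrib)
  finally have "24 * 4 ^ e \<le> (2 * 2 ^ e) * (12 * 3 ^ e :: int)" by simp
  also have "\<dots> \<le> (n - 1) * (12 * 3 ^ e)" by (rule mult_right_mono[OF n(2)]) simp
  also have "\<dots> \<le> (n - 1) * ((n - 2) * (n - 3 - 4 * 2 ^ e) + 12 * 3 ^ e)"
    using n mult_nonneg_nonneg[OF nn] by (intro mult_left_mono) linarith+
  finally have "0 \<le> n * ((n - 1) * ((n - 2) * (n - 3 - 4 * 2 ^ e) + 12 * 3 ^ e) - 24 * 4 ^ e)"
    using n by simp
  then show ?thesis by (simp add: moser_quartic_def add_nonneg_pos)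
qed

text \<open>
When both \<open>n\<close> and the cofactor \<open>B\<close> in \<open>n * B = - 24 * 5 ^ e\<close> are divisible by \<open>5 ^ 4 = 625\<close>, the constant term of
\<open>B\<close>, considered as a polynomial in \<open>n\<close>, is divisible by 625; it is \<open>- 2\<close> times the expression treated in
\<open>moser_exponents_mod_500\<close>.
With exponent 3 in place of 4 the class of \<open>e = 4\<close> modulo 100 would remain, and \<open>n = 5\<close>, \<open>e = 4\<close> is a genuine
zero, which no choice of moduli can sieve out.
\<close>

lemma moser_exponents_of_root:
  fixes d :: int
  assumes root: "moser_quartic (d * 5 ^ a) (2 ^ e) (3 ^ e) (4 ^ e) (5 ^ e) = 0"
    and "d \<noteq> 0" "d dvd 24" "a \<ge> 4" "e \<ge> a + 4"
  shows "e mod 500 \<in> {24, 31, 72, 124, 172, 224, 272, 324, 372, 374, 424, 472}"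
proof (rule moser_exponents_mod_500)
  define n where "n = d * 5 ^ a"
  define B :: int where "B = (n - 1) * ((n - 2) * (n - 3 - 4 * 2 ^ e) + 12 * 3 ^ e) - 24 * 4 ^ e"
  obtain f where f: "e = a + 4 + f" using \<open>e \<ge> a + 4\<close> le_Suc_ex by blast
  obtain b where b: "a = 4 + b" using \<open>a \<ge> 4\<close> le_Suc_ex by blast
  have "5 ^ a * (d * B + 24 * (625 * 5 ^ f)) = moser_quartic n (2 ^ e) (3 ^ e) (4 ^ e) (5 ^ e)"
    unfolding moser_quartic_def B_def[symmetric] by (simp add: n_def f power_add algebra_simps)
  then have "d * B + 24 * (625 * 5 ^ f) = 0" using root by (simp add: n_def)
  then have "d * B = 625 * (- 24 * 5 ^ f)" by simp
  then have "625 dvd d * B" by (metis dvd_triv_left)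
  moreover have "coprime 625 d"
  proof (rule coprime_divisors[OF dvd_refl \<open>d dvd 24\<close>])
    show "coprime (625 :: int) 24" by (simp add: coprime_iff_gcd_eq_1 gcd_non_0_int)
  qed
  ultimately have B: "625 dvd B" by (simp add: coprime_dvd_mult_right_iff)
  define S :: int where "S = 3 + 4 * 2 ^ e + 6 * 3 ^ e + 12 * 4 ^ e"
  define R where "R = n\<^sup>2 - 3 * n + 2 - (3 + 4 * 2 ^ e) * (n - 3) + 12 * 3 ^ e"
  have "625 dvd n * R" by (simp add: n_def b power_add)
  then have "625 dvd n * R - B" using B by (rule dvd_diff)
  moreover have "n * R - B = 2 * S"
    unfolding B_def R_def S_def by (simp add: algebra_simps power2_eq_square)
  ultimately have "625 dvd 2 * S" by simp
  then have "625 dvd S" by presburger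
  then show "625 dvd (3 + 4 * 2 ^ e + 6 * 3 ^ e + 12 * 4 ^ e :: int)" by (simp only: S_def)
qed

text \<open>
With \<open>k = e + 1\<close> the equation gives \<open>n = d * 5 ^ a\<close>, where \<open>d\<close> divides 24 and \<open>a \<le> e\<close>. The exponents of 5 in \<open>n\<close> and in its cofactor
are \<open>a\<close> and \<open>e - a\<close>; if both are at least 4, the sieves modulo 101 and 251 apply. If
\<open>a\<close> is smaller, only finitely many \<open>n\<close> are left, and if \<open>e - a\<close> is smaller, then \<open>n \<ge> 5 ^ (e - 3)\<close> exceeds the
largest root.
\<close>

lemma moser_poly_5_nonzero:
  assumes n: "n > 5" "n \<noteq> 10" and "k \<ge> 1"
  shows "moser_poly 5 k n \<noteq> 0"
proof
  assume zero: "moser_poly 5 k n = 0"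
  obtain e where k: "k = Suc e" using \<open>k \<ge> 1\<close> by (cases k) auto
  have root: "moser_quartic (int n) (2 ^ e) (3 ^ e) (4 ^ e) (5 ^ e) = 0"
    using moser_poly_5[of e n] zero by (simp add: k moser_quartic_def algebra_simps)
  then have "int n dvd 24 * 5 ^ e"
    unfolding moser_quartic_def by (metis dvd_add_right_iff dvd_triv_left dvd_0_right)
  then have "int n dvd int (24 * 5 ^ e)" by simp
  then have "n dvd 24 * 5 ^ e" by (simp only: of_nat_dvd_iff)
  then obtain d a where d: "n = d * 5 ^ a" "d dvd 24" "a \<le> e"
    by (rule dvd_mult_prime_powerE) simp
  have d24: "int d \<in> set divisors_24" using dvd_24_cases[OF d(2)] by (auto simp: divisors_24_def)
  have root': "moser_quartic (int d * 5 ^ a) (2 ^ e) (3 ^ e) (4 ^ e) (5 ^ e) = 0" using root by (simp add: d(1))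
  consider "a \<le> 3" | "a \<ge> 4" "e \<le> a + 3" | "a \<ge> 4" "e \<ge> a + 4" by linarith
  then show False
  proof cases
    case 1
    let ?das = "filter (\<lambda>(d, a). d * 5 ^ a > 5 \<and> d * 5 ^ a \<noteq> 10) (List.product divisors_24 [0..<4])"
    have "int d * 5 ^ a = int n" by (simp add: d(1))
    then have "(int d, a mod 36) \<in> set ?das" using 1 d24 n by simp
    then have "(int d, a mod 36) \<in> set (sieve 63973 (36, 36, 36, 36) e ?das)"
      by (intro mem_sieve root') simp_all
    moreover have "sieve 63973 (36, 36, 36, 36) (e mod 36) ?das = []"
      using sieve_small by (simp add: list_all_iff)
    ultimately show False by (simp add: sieve_mod)
  next
    case 2
    have "4 * 2 ^ e + 3 \<le> (2::nat) ^ (a + 5) + 3" using power_increasing[of "e + 2" "a + 5" "2::nat"] 2 by simp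
    also have "\<dots> \<le> 5 ^ a" using 2(1) by (induction a rule: dec_induct) (simp_all add: power_add)
    also have "\<dots> \<le> n" using n by (cases d) (auto simp: d(1))
    finally have "int (4 * 2 ^ e + 3) \<le> int n" by (simp only: of_nat_le_iff)
    then show False using moser_quartic_pos[of e "int n"] root by simp
  next
    case 3
    have "int d dvd 24" using d(2) by (metis of_nat_dvd_iff of_nat_numeral)
    moreover have "int d \<noteq> 0" using n d(1) by (cases "d = 0") auto
    ultimately have e: "e mod 500 \<in> {24, 31, 72, 124, 172, 224, 272, 324, 372, 374, 424, 472}"
      using moser_exponents_of_root[OF root'] 3 by simp
    have "e mod 100 = e mod 500 mod 100" by (simp add: mod_mod_cancel)
    then have e100: "e mod 100 = 24 \<and> e mod 500 \<in> {24, 124, 224, 324, 424} \<or> e mod 100 = 31 \<and> e mod 500 \<in> {31} \<or>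
        e mod 100 = 72 \<and> e mod 500 \<in> {72, 172, 272, 372, 472} \<or> e mod 100 = 74 \<and> e mod 500 \<in> {374}"
      using e by auto
    have "(int d, a mod 25) \<in> set (List.product divisors_24 [0..<25])" using d24 by simp
    then have "(int d, a mod 25) \<in> set (sieve 101 (100, 100, 50, 25) e (List.product divisors_24 [0..<25]))"
      by (intro mem_sieve root') simp_all
    then have c1: "(int d, a mod 25) \<in> set (sieve 101 (100, 100, 50, 25) (e mod 100) (List.product divisors_24 [0..<25]))"
      by (simp add: sieve_mod)
    have c2: "(int d, a mod 25) \<in> set das \<Longrightarrow> (int d, a mod 25) \<in> set (sieve 251 (50, 125, 25, 25) (e mod 500) das)" for das
      using mem_sieve[OF root', of 50 251 125 25 25 das] by (simp add: sieve_mod)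
    from e100 show False
    proof (elim disjE conjE)
      assume "e mod 100 = 24" and m: "e mod 500 \<in> {24, 124, 224, 324, 424}"
      with c1 have "(int d, a mod 25) \<in> set [(1, 5), (1, 20), (2, 6), (3, 24), (8, 0), (12, 18), (24, 2), (24, 17)]"
        by (simp only: sieve_101)
      from c2[OF this] m sieve_251(1) show False by (auto simp: list_all_iff)
    next
      assume "e mod 100 = 31" and m: "e mod 500 \<in> {31}"
      with c1 have "(int d, a mod 25) \<in> set [(2, 5), (3, 23)]"
        by (simp only: sieve_101)
      from c2[OF this] m sieve_251(2) show False by (auto simp: list_all_iff)
    next
      assume "e mod 100 = 72" and m: "e mod 500 \<in> {72, 172, 272, 372, 472}"
      with c1 have "(int d, a mod 25) \<in> set [(2, 19), (3, 12), (8, 10), (12, 3)]"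
        by (simp only: sieve_101)
      from c2[OF this] m sieve_251(3) show False by (auto simp: list_all_iff)
    next
      assume "e mod 100 = 74" and m: "e mod 500 \<in> {374}"
      with c1 have "(int d, a mod 25) \<in> set [(4, 22), (6, 15), (8, 9), (12, 2)]"
        by (simp only: sieve_101)
      from c2[OF this] m sieve_251(4) show False by (auto simp: list_all_iff)
    qed
  qed
qed

section \<open>Injectivity of the elementary symmetric partition maps\<close>

theorem theorem1p4:
  shows "(\<forall>s n :: nat. s \<ge> 2 \<longrightarrow> n > s \<longrightarrow> (\<forall>k\<in>{1..n}. moser_poly s k n \<noteq> 0) \<longrightarrow>
            inj_on (pre s) (partitions_of_length n))
       \<and> (\<forall>n :: nat. n > 5 \<longrightarrow> n \<noteq> 10 \<longrightarrow> inj_on (pre 5) (partitions_of_length n))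
       \<and> (\<forall>n :: nat. n > 4 \<longrightarrow> n \<notin> {8, 12} \<longrightarrow> inj_on (pre 4) (partitions_of_length n))
       \<and> (\<forall>n :: nat. n > 3 \<longrightarrow> n \<notin> {6, 27, 486} \<longrightarrow> inj_on (pre 3) (partitions_of_length n))"
proof -
  have five: "inj_on (pre 5) (partitions_of_length n)" if "n > 5" "n \<noteq> 10" for n
    using that by (intro inj_on_pre moser_poly_5_nonzero) auto
  have four: "inj_on (pre 4) (partitions_of_length n)" if "n > 4" "n \<notin> {8, 12}" for n
    using that by (intro inj_on_pre moser_poly_4_nonzero) auto
  have three: "inj_on (pre 3) (partitions_of_length n)" if "n > 3" "n \<notin> {6, 27, 486}" for n
    using that by (intro inj_on_pre moser_poly_3_nonzero) auto
  show ?thesis using inj_on_pre five four three by blast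
qed

end
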